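(* Let $G$ be a connected bipartite graph on $n$ vertices with matching number $p$ such that $G\neq K_{p,n-p}$. Then $\rho(G)<\rho(K_{p,n-p})$.
   Context: All graphs are simple and finite; equality of graphs means isomorphism. For a connected graph $G$ with vertices $v_1,\dots,v_n$, let $d_{ij}$ be the distance (number of edges of a shortest path) between $v_i$ and $v_j$. The Harary matrix $RD(G)$ is the $n\times n$ matrix with $(i,j)$-entry $1/d_{ij}$ if $i\ne j$ and $0$ if $i=j$. The Harary spectral radius $\rho(G)$ is the spectral radius (largest eigenvalue) of $RD(G)$. The matching number of $G$ is the number of edges in a maximum matching of $G$. $K_{a,b}$ is the complete bipartite graph with parts of sizes $a$ and $b$. *)

theory Defs
  imports
    "Jordan_Normal_Form.Spectral_Radius"
    "Graph_Theory.Graph_Theory"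
begin

text \<open>
  Simple finite graphs are rendered by the locale \<open>pair_graph\<close>: an undirected edge between \<open>u\<close> and
  \<open>v\<close> is the pair of opposite arcs \<open>(u,v)\<close>, \<open>(v,u)\<close>.
\<close>

definition edges :: "'a pair_pre_digraph \<Rightarrow> 'a set set" where
  "edges G = {{u, v} | u v. (u, v) \<in> parcs G}"

definition bipartite :: "'a pair_pre_digraph \<Rightarrow> bool" where
  "bipartite G \<longleftrightarrow> (\<exists>U V. pverts G = U \<union> V \<and> U \<inter> V = {} \<and> parcs G \<subseteq> U \<times> V \<union> V \<times> U)"

definition matching :: "'a pair_pre_digraph \<Rightarrow> 'a set set \<Rightarrow> bool" where
  "matching G M \<longleftrightarrow> M \<subseteq> edges G \<and> (\<forall>e\<in>M. \<forall>f\<in>M. e \<noteq> f \<longrightarrow> e \<inter> f = {})"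

definition matching_number :: "'a pair_pre_digraph \<Rightarrow> nat" where
  "matching_number G = Max {card M | M. matching G M}"

definition complete_bipartite_graph :: "nat \<Rightarrow> nat \<Rightarrow> nat pair_pre_digraph" where
  "complete_bipartite_graph a b =
     \<lparr> pverts = {0..<a+b},
       parcs = {0..<a} \<times> {a..<a+b} \<union> {a..<a+b} \<times> {0..<a} \<rparr>"

lemma pair_graph_complete_bipartite_graph: "pair_graph (complete_bipartite_graph a b)"
  and complete_bipartite_graph: "K\<^bsub>a,b\<^esub> (with_proj (complete_bipartite_graph a b))"
proof -
  show *: "K\<^bsub>a,b\<^esub> (with_proj (complete_bipartite_graph a b))"
    unfolding complete_bipartite_digraph_pair_def
    by (intro conjI exI[of _ "{0..<a}"] exI[of _ "{a..<a+b}"])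
       (auto simp: complete_bipartite_graph_def)
  then show "pair_graph (complete_bipartite_graph a b)"
    by (rule pair_graphI_complete_bipartite)
qed

text \<open>Only meaningful if there is a path from \<open>u\<close> to \<open>v\<close>.\<close>

definition graph_dist :: "'a pair_pre_digraph \<Rightarrow> 'a \<Rightarrow> 'a \<Rightarrow> nat" where
  "graph_dist G u v = (LEAST k. \<exists>p. pre_digraph.apath (with_proj G) u p v \<and> length p = k)"

text \<open>The list \<open>vs\<close> is the numbering \<open>v\<^sub>1, \<dots>, v\<^sub>n\<close> of the vertices.\<close>

definition harary_matrix :: "'a pair_pre_digraph \<Rightarrow> 'a list \<Rightarrow> real mat" where
  "harary_matrix G vs =
     mat (length vs) (length vs)
       (\<lambda>(i, j). if i = j then 0 else 1 / real (graph_dist G (vs ! i) (vs ! j)))"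

definition vertex_numbering :: "'a pair_pre_digraph \<Rightarrow> 'a list \<Rightarrow> bool" where
  "vertex_numbering G vs \<longleftrightarrow> distinct vs \<and> set vs = pverts G"

text \<open>
  The library's spectral radius is the largest modulus of a complex eigenvalue.  The choice of the
  numbering is immaterial, see \<open>harary_spectral_radius_eq\<close> below.
\<close>

definition harary_spectral_radius :: "'a pair_pre_digraph \<Rightarrow> real" where
  "harary_spectral_radius G =
     spectral_radius (map_mat complex_of_real (harary_matrix G (SOME vs. vertex_numbering G vs)))"

lemma spectrum_harary_matrix_subset:
  assumes vs: "vertex_numbering G vs" and ws: "vertex_numbering G ws"
  shows "spectrum (map_mat complex_of_real (harary_matrix G vs))
       \<subseteq> spectrum (map_mat complex_of_real (harary_matrix G ws))"
proof
  fix k assume "k \<in> spectrum (map_mat complex_of_real (harary_matrix G vs))"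
  define n where "n = length vs"
  define h where
    "h x y = complex_of_real (if x = y then 0 else 1 / real (graph_dist G x y))" for x y
  have len: "length ws = n"
    using vs ws unfolding n_def vertex_numbering_def by (metis distinct_card)
  have row: "(map_mat complex_of_real (harary_matrix G us) *\<^sub>v vec n (\<lambda>i. f (us ! i))) $ i
      = (\<Sum>x\<in>pverts G. h (us ! i) x * f x)"
    if us: "vertex_numbering G us" and l: "length us = n" and i: "i < n" for us i and f :: "'a \<Rightarrow> complex"
  proof -
    have d: "distinct us" "set us = pverts G" using us by (auto simp: vertex_numbering_def)
    have "(map_mat complex_of_real (harary_matrix G us) *\<^sub>v vec n (\<lambda>i. f (us ! i))) $ i
        = (\<Sum>j = 0..<n. h (us ! i) (us ! j) * f (us ! j))"
      using i l d(1)
      by (auto simp: harary_matrix_def scalar_prod_def h_def nth_eq_iff_index_eq intro!: sum.cong)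
    also have "\<dots> = (\<Sum>x\<in>pverts G. h (us ! i) x * f x)"
      using sum.reindex_bij_betw[OF bij_betw_nth[OF d(1), of "{0..<n}" "pverts G"],
          of "\<lambda>x. h (us ! i) x * f x"] l d(2)
      by (simp add: lessThan_atLeast0)
    finally show ?thesis .
  qed
  have dim: "dim_row (harary_matrix G vs) = n" "dim_row (harary_matrix G ws) = n"
    by (simp_all add: harary_matrix_def n_def len)
  obtain v where v: "v \<in> carrier_vec n" "v \<noteq> 0\<^sub>v n"
      "map_mat complex_of_real (harary_matrix G vs) *\<^sub>v v = k \<cdot>\<^sub>v v"
    using \<open>k \<in> _\<close> unfolding spectrum_def eigenvalue_def eigenvector_def by (auto simp: dim)
  define f where "f x = v $ (THE i. i < n \<and> vs ! i = x)" for x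
  have f_nth: "f (vs ! i) = v $ i" if "i < n" for i
  proof -
    have "(THE j. j < n \<and> vs ! j = vs ! i) = i"
      using that vs by (intro the_equality) (auto simp: vertex_numbering_def n_def nth_eq_iff_index_eq)
    then show ?thesis by (simp add: f_def)
  qed
  have v_eq: "v = vec n (\<lambda>i. f (vs ! i))"
    using v(1) by (intro eq_vecI) (auto simp: f_nth)
  have in_vs: "\<exists>i<n. vs ! i = x" if "x \<in> pverts G" for x
    using that vs unfolding vertex_numbering_def n_def by (metis in_set_conv_nth)
  have in_ws: "\<exists>i<n. ws ! i = x" if "x \<in> pverts G" for x
    using that ws len unfolding vertex_numbering_def by (metis in_set_conv_nth)
  have eq: "(\<Sum>y\<in>pverts G. h x y * f y) = k * f x" if x: "x \<in> pverts G" for x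
  proof -
    obtain i where i: "i < n" "vs ! i = x" using in_vs[OF x] by blast
    have "(\<Sum>y\<in>pverts G. h x y * f y) = (k \<cdot>\<^sub>v v) $ i"
      using row[OF vs n_def[symmetric] i(1), of f] v(3) i(2) by (simp flip: v_eq)
    then show ?thesis using i v(1) f_nth by auto
  qed
  define w where "w = vec n (\<lambda>i. f (ws ! i))"
  have "map_mat complex_of_real (harary_matrix G ws) *\<^sub>v w = k \<cdot>\<^sub>v w"
  proof (intro eq_vecI)
    fix i assume "i < dim_vec (k \<cdot>\<^sub>v w)"
    then have i: "i < n" by (simp add: w_def)
    then have "ws ! i \<in> pverts G" using ws len unfolding vertex_numbering_def by (metis nth_mem)
    then show "(map_mat complex_of_real (harary_matrix G ws) *\<^sub>v w) $ i = (k \<cdot>\<^sub>v w) $ i"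
      using row[OF ws len i, of f] eq[of "ws ! i"] i by (simp add: w_def)
  qed (simp add: dim w_def)
  moreover have "w \<noteq> 0\<^sub>v n"
  proof
    assume w0: "w = 0\<^sub>v n"
    have "f x = 0" if "x \<in> pverts G" for x
      using in_ws[OF that] w0 unfolding w_def by (metis index_vec index_zero_vec(1))
    moreover have "vs ! i \<in> pverts G" if "i < n" for i
      using that vs unfolding vertex_numbering_def n_def by (metis nth_mem)
    ultimately have "v = 0\<^sub>v n" using v(1) f_nth by (intro eq_vecI) force+
    with v(2) show False by simp
  qed
  ultimately show "k \<in> spectrum (map_mat complex_of_real (harary_matrix G ws))"
    unfolding spectrum_def eigenvalue_def eigenvector_def
    by (auto simp: dim w_def intro!: exI[of _ w])
qed

lemma harary_spectral_radius_eq: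
  assumes "vertex_numbering G vs"
  shows "harary_spectral_radius G = spectral_radius (map_mat complex_of_real (harary_matrix G vs))"
proof -
  have "vertex_numbering G (SOME vs. vertex_numbering G vs)"
    using assms by (rule someI)
  then show ?thesis
    unfolding harary_spectral_radius_def spectral_radius_def
    using spectrum_harary_matrix_subset[OF assms] spectrum_harary_matrix_subset[OF _ assms]
    by (metis subset_antisym)
qed

end

theory Submission
  imports "HOL-Analysis.Brouwer_Fixpoint" "HOL-Analysis.Cartesian_Euclidean_Space" Defs
begin

text \<open>
  The proof compares Perron vectors.  Instead of \<open>RD(G)\<close> it works with the kernel
  \<open>2 RD(G) + I\<close> on the vertices, whose largest eigenvalue is \<open>2 \<rho>(G) + 1\<close>: in a bipartite graph
  this kernel is at most \<open>1\<close> between vertices of the same side, \<open>2\<close> between vertices of different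
  sides, and at most \<open>2/3\<close> if the latter are not adjacent, since their distance is then odd and at
  least \<open>3\<close>.

  By Koenig's theorem (\<open>koenig\<close>, obtained from Hall's theorem applied to both sides of a minimum
  vertex cover) there is a vertex cover \<open>A \<union> B\<close> with \<open>p\<close> vertices, \<open>A\<close> in one side \<open>U\<close> and \<open>B\<close> in
  the other side \<open>V\<close>.  A maximum matching pairs its vertices with vertices outside the cover, and
  this yields \<open>|B| \<le> |U - A|\<close> and \<open>|A| \<le> |V - B|\<close>.

  If \<open>A\<close> or \<open>B\<close> is empty, then \<open>G\<close> is a proper spanning subgraph of \<open>K\<^bsub>p,n-p\<^esub>\<close>.  No kernel entry
  is larger than that of \<open>K\<^bsub>p,n-p\<^esub>\<close>, one is smaller, and the strict form of Perron-Frobenius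
  monotonicity (\<open>subinvariant_comparison\<close>) applies.

  Otherwise let \<open>H\<close> be the kernel that has the largest values which the cover permits: it depends
  only on the classes \<open>A\<close>, \<open>B\<close>, \<open>U - A\<close>, \<open>V - B\<close> of its two arguments, and it is \<open>2/3\<close> exactly
  between \<open>U - A\<close> and \<open>V - B\<close>.  Now \<open>H\<close> is not below the kernel of the complete bipartite graph
  with parts \<open>A \<union> B\<close> and \<open>(U - A) \<union> (V - B)\<close>, because the distance between \<open>A\<close> and \<open>B\<close> grows
  from \<open>1\<close> to \<open>2\<close> when they become one part.  But let \<open>\<alpha>\<close>, \<open>\<beta>\<close>, \<open>\<gamma>\<close>, \<open>\<delta>\<close> be the sums of the
  Perron vector of \<open>H\<close> over the four classes.  Passing to the complete bipartite graph changes the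
  quadratic form at this vector by
  \<open>2 (\<alpha>\<gamma> + \<beta>\<delta> + \<gamma>\<delta>/3 - \<alpha>\<beta>)\<close>, and the two inequalities between the class sizes force this to be
  positive (\<open>class_sums_inequality\<close>).  Hence the largest eigenvalue increases strictly
  (\<open>four_class_eigenvalue_less\<close>).
\<close>

section \<open>Perron vectors of positive kernels\<close>

text \<open>
  The normalised map \<open>x \<mapsto> Q x / \<parallel>Q x\<parallel>\<^sub>1\<close> sends the standard simplex into itself, so it has a fixed
  point by Brouwer's theorem; the image of a nonnegative nonzero vector under \<open>Q\<close> is positive, and
  therefore so is the fixed point.
\<close>

lemma positive_kernel_perron:
  fixes Q :: "'n::finite \<Rightarrow> 'n \<Rightarrow> real"
  assumes pos: "\<And>i j. 0 < Q i j"
  obtains \<theta> z where "0 < \<theta>" "\<And>i. 0 < z i" "\<And>i. (\<Sum>j\<in>UNIV. Q i j * z j) = \<theta> * z i"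
proof -
  define S :: "(real ^ 'n) set" where
    "S = {x. (\<forall>i. 0 \<le> vec_nth x i) \<and> (\<Sum>i\<in>UNIV. vec_nth x i) = 1}"
  define q :: "real ^ 'n \<Rightarrow> 'n \<Rightarrow> real" where "q x i = (\<Sum>j\<in>UNIV. Q i j * vec_nth x j)" for x i
  define f :: "real ^ 'n \<Rightarrow> real ^ 'n" where "f x = (\<chi> i. q x i / (\<Sum>i\<in>UNIV. q x i))" for x
  have q_pos: "0 < q x i" if "x \<in> S" for x i
  proof -
    have ge: "\<And>j. 0 \<le> vec_nth x j" and one: "(\<Sum>j\<in>UNIV. vec_nth x j) = 1"
      using that by (auto simp: S_def)
    obtain j where "0 < vec_nth x j"
      using one ge by (metis less_eq_real_def sum.neutral zero_neq_one)
    then show ?thesis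
      unfolding q_def using pos[of i] ge
      by (intro sum_pos2[where i = j]) (auto intro: mult_nonneg_nonneg less_imp_le)
  qed
  have total_pos: "0 < (\<Sum>i\<in>UNIV. q x i)" if "x \<in> S" for x
    using q_pos[OF that] by (intro sum_pos) auto
  have "compact S"
    unfolding compact_eq_bounded_closed
  proof
    have "vec_nth x i \<le> 1" if "x \<in> S" for x i
      using that member_le_sum[of i UNIV "vec_nth x"] by (auto simp: S_def)
    then have "S \<subseteq> cbox 0 1" by (auto simp: S_def mem_box_cart)
    then show "bounded S" using bounded_cbox bounded_subset by blast
    have "S = (\<Inter>i. {x. 0 \<le> vec_nth x i}) \<inter> {x. (\<Sum>i\<in>UNIV. vec_nth x i) = 1}"
      by (auto simp: S_def)
    moreover have "closed {x::real^'n. 0 \<le> vec_nth x i}" for i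
      by (intro closed_Collect_le continuous_intros)
    moreover have "closed {x::real^'n. (\<Sum>i\<in>UNIV. vec_nth x i) = 1}"
      by (intro closed_Collect_eq continuous_intros)
    ultimately show "closed S" by auto
  qed
  moreover have "convex S"
    unfolding S_def convex_def
    by (auto simp: sum.distrib simp flip: sum_distrib_left)
  moreover have "S \<noteq> {}"
  proof -
    have "(\<chi> i. 1 / real CARD('n)) \<in> S" by (simp add: S_def)
    then show ?thesis by blast
  qed
  moreover have "continuous_on S f"
    unfolding f_def using total_pos
    by (auto simp: q_def dest: less_imp_neq[THEN not_sym]
        intro!: continuous_on_vec_lambda continuous_on_divide continuous_on_sum continuous_intros)
  moreover have "f \<in> S \<rightarrow> S"
  proof
    fix x assume x: "x \<in> S"
    have "0 \<le> q x i" for i using q_pos[OF x] by (simp add: less_imp_le)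
    moreover have "(\<Sum>i\<in>UNIV. q x i / (\<Sum>i\<in>UNIV. q x i)) = 1"
      using total_pos[OF x] by (simp flip: sum_divide_distrib)
    ultimately show "f x \<in> S"
      using total_pos[OF x] by (simp add: S_def f_def)
  qed
  ultimately obtain x where x: "x \<in> S" "f x = x"
    using brouwer[of S f] by blast
  define \<theta> where "\<theta> = (\<Sum>i\<in>UNIV. q x i)"
  have th: "0 < \<theta>" using total_pos[OF x(1)] by (simp add: \<theta>_def)
  have eq: "vec_nth x i = q x i / \<theta>" for i
    using arg_cong[OF x(2), of "\<lambda>v. vec_nth v i"] by (simp add: f_def \<theta>_def)
  show thesis
  proof (rule that[OF th])
    show "0 < vec_nth x i" for i using eq q_pos[OF x(1)] th by simp
    show "(\<Sum>j\<in>UNIV. Q i j * vec_nth x j) = \<theta> * vec_nth x i" for i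
      using eq[of i] th by (simp add: q_def)
  qed
qed

text \<open>
  The pairing \<open>\<langle>w, z\<rangle> = \<Sum> w x * z x\<close> decides: as \<open>H\<close> is symmetric,
  \<open>\<kappa> \<langle>w, z\<rangle> \<le> \<langle>M w, z\<rangle> \<le> \<langle>H w, z\<rangle> = \<langle>w, H z\<rangle> = \<theta> \<langle>w, z\<rangle>\<close>.  Equality would make \<open>w\<close> an
  eigenvector of the positive kernel \<open>H\<close>, hence positive, and then a single entry with \<open>M < H\<close>
  makes its row strict.  The vector \<open>w\<close> only satisfies an inequality because it will consist of the
  moduli of the entries of a complex eigenvector.
\<close>

lemma subinvariant_comparison:
  fixes M H :: "'a \<Rightarrow> 'a \<Rightarrow> real"
  assumes fin: "finite V"
    and le: "\<And>x y. x \<in> V \<Longrightarrow> y \<in> V \<Longrightarrow> M x y \<le> H x y"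
    and H_pos: "\<And>x y. x \<in> V \<Longrightarrow> y \<in> V \<Longrightarrow> 0 < H x y"
    and H_sym: "\<And>x y. x \<in> V \<Longrightarrow> y \<in> V \<Longrightarrow> H x y = H y x"
    and z: "\<And>x. x \<in> V \<Longrightarrow> 0 < z x" "\<And>x. x \<in> V \<Longrightarrow> (\<Sum>y\<in>V. H x y * z y) = \<theta> * z x"
    and w: "\<And>x. x \<in> V \<Longrightarrow> 0 \<le> w x" "v \<in> V" "w v \<noteq> 0"
      "\<And>x. x \<in> V \<Longrightarrow> \<kappa> * w x \<le> (\<Sum>y\<in>V. M x y * w y)"
  shows "\<kappa> \<le> \<theta>" and "\<lbrakk>x \<in> V; y \<in> V; M x y < H x y\<rbrakk> \<Longrightarrow> \<kappa> < \<theta>"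
proof -
  define S where "S = (\<Sum>x\<in>V. w x * z x)"
  have wv: "0 < w v" using w(1)[of v] w(2,3) by auto
  have S: "0 < S"
    unfolding S_def using wv w(1,2) z(1) fin
    by (intro sum_pos2[where i = v]) (auto intro!: mult_nonneg_nonneg simp: less_imp_le)
  have row: "\<kappa> * w x \<le> (\<Sum>y\<in>V. H x y * w y)" if "x \<in> V" for x
    using w(4)[OF that] le[OF that] w(1)
    by (meson mult_right_mono order_trans sum_mono)
  have ex: "(\<Sum>x\<in>V. z x * (\<Sum>y\<in>V. H x y * w y)) = \<theta> * S"
  proof -
    have "(\<Sum>x\<in>V. z x * (\<Sum>y\<in>V. H x y * w y)) = (\<Sum>x\<in>V. \<Sum>y\<in>V. z x * (H x y * w y))"
      by (simp add: sum_distrib_left)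
    also have "\<dots> = (\<Sum>y\<in>V. \<Sum>x\<in>V. z x * (H x y * w y))"
      by (rule sum.swap)
    also have "\<dots> = (\<Sum>y\<in>V. w y * (\<Sum>x\<in>V. H y x * z x))"
      using H_sym by (auto simp: sum_distrib_left mult_ac intro!: sum.cong)
    also have "\<dots> = (\<Sum>y\<in>V. \<theta> * (w y * z y))"
      using z(2) by (auto intro!: sum.cong)
    finally show ?thesis by (simp add: S_def sum_distrib_left)
  qed
  have kS: "(\<Sum>x\<in>V. z x * (\<kappa> * w x)) = \<kappa> * S"
    by (simp add: S_def sum_distrib_left mult_ac)
  have "(\<Sum>x\<in>V. z x * (\<kappa> * w x)) \<le> (\<Sum>x\<in>V. z x * (\<Sum>y\<in>V. H x y * w y))"
    using row z(1) by (intro sum_mono mult_left_mono) (auto intro: less_imp_le)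
  then have "\<kappa> * S \<le> \<theta> * S" by (simp only: ex kS)
  with S show le_theta: "\<kappa> \<le> \<theta>" by simp
  assume xy: "x \<in> V" "y \<in> V" "M x y < H x y"
  show "\<kappa> < \<theta>"
  proof (rule ccontr)
    assume "\<not> \<kappa> < \<theta>"
    with le_theta have eq: "\<kappa> = \<theta>" by simp
    have tight: "\<kappa> * w u = (\<Sum>y\<in>V. H u y * w y)" if u: "u \<in> V" for u
    proof (rule ccontr)
      assume "\<kappa> * w u \<noteq> (\<Sum>y\<in>V. H u y * w y)"
      with row[OF u] have "\<kappa> * w u < (\<Sum>y\<in>V. H u y * w y)" by simp
      then have "(\<Sum>x\<in>V. z x * (\<kappa> * w x)) < (\<Sum>x\<in>V. z x * (\<Sum>y\<in>V. H x y * w y))"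
        using row z(1) u fin
        by (intro sum_strict_mono_ex1) (auto intro: mult_left_mono less_imp_le)
      then have "\<kappa> * S < \<theta> * S" by (simp only: ex kS)
      then show False using eq by simp
    qed
    have "0 < (\<Sum>u\<in>V. H y u * w u)"
      using fin w(1,2) wv H_pos[OF xy(2)]
      by (intro sum_pos2[where i = v]) (auto intro!: mult_nonneg_nonneg simp: less_imp_le)
    then have "w y \<noteq> 0" using tight[OF xy(2)] by auto
    then have "0 < w y" using w(1)[OF xy(2)] by simp
    then have "(\<Sum>y\<in>V. M x y * w y) < (\<Sum>y\<in>V. H x y * w y)"
      using fin xy le[OF xy(1)] w(1)
      by (intro sum_strict_mono_ex1) (auto intro!: mult_right_mono bexI[of _ y])
    with w(4)[OF xy(1)] tight[OF xy(1)] show False by simp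
  qed
qed

section \<open>Eigenvalues of kernels that depend on classes of vertices\<close>

lemma sum_over_classes:
  fixes \<phi> :: "'b::finite \<Rightarrow> real"
  assumes "finite S"
  shows "(\<Sum>x\<in>S. \<phi> (\<tau> x)) = (\<Sum>b\<in>UNIV. real (card {x \<in> S. \<tau> x = b}) * \<phi> b)"
proof -
  have "(\<Sum>x\<in>S. \<phi> (\<tau> x)) = (\<Sum>b\<in>UNIV. \<Sum>x\<in>{x \<in> S. \<tau> x = b}. \<phi> (\<tau> x))"
    using assms by (intro sum.group[symmetric]) auto
  also have "\<dots> = (\<Sum>b\<in>UNIV. real (card {x \<in> S. \<tau> x = b}) * \<phi> b)"
    by (intro sum.cong) auto
  finally show ?thesis .
qed

lemma sum_bool_pair:
  "(\<Sum>b\<in>UNIV. \<phi> b) = \<phi> (True, True) + \<phi> (False, True) + \<phi> (True, False) + \<phi> (False, False)"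
  for \<phi> :: "bool \<times> bool \<Rightarrow> real"
proof -
  have *: "(UNIV :: (bool \<times> bool) set) = {(True, True), (False, True), (True, False), (False, False)}" by auto
  show ?thesis unfolding * by simp
qed

text \<open>
  The Perron vector of the complete bipartite graph with parts of sizes \<open>p\<close> and \<open>m\<close>, which is
  constant on each part.
\<close>

lemma two_class_perron:
  fixes p m :: nat
  assumes "0 < p" "0 < m"
  obtains \<kappa> x y :: real where "0 < x" "0 < y"
    "real p * x + 2 * real m * y = \<kappa> * x" "2 * real p * x + real m * y = \<kappa> * y"
proof -
  define Q where "Q i j = (if i = j then 1 else 2) * real (if j then p else m)" for i j :: bool
  have "0 < Q i j" for i j using assms by (simp add: Q_def)
  then obtain \<kappa> z where z: "\<And>i. 0 < z i" "\<And>i. (\<Sum>j\<in>UNIV. Q i j * z j) = \<kappa> * z i"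
    using positive_kernel_perron[of Q] by metis
  have "real p * z True + 2 * real m * z False = \<kappa> * z True"
    and "2 * real p * z True + real m * z False = \<kappa> * z False"
    using z(2)[of True] z(2)[of False] by (simp_all add: Q_def UNIV_bool)
  then show thesis by (rule that[OF z(1) z(1)])
qed

lemma two_class_kernel_eigenvector:
  fixes x y :: real
  assumes fin: "finite C" "finite R" and disj: "C \<inter> R = {}"
    and eqs: "real (card C) * x + 2 * real (card R) * y = \<kappa> * x"
    "2 * real (card C) * x + real (card R) * y = \<kappa> * y"
    and u: "u \<in> C \<union> R"
  shows "(\<Sum>v\<in>C \<union> R. (if u \<in> C \<longleftrightarrow> v \<in> C then 1 else 2) * (if v \<in> C then x else y))
    = \<kappa> * (if u \<in> C then x else y)"
proof -
  let ?g = "\<lambda>v. (if u \<in> C \<longleftrightarrow> v \<in> C then 1 else 2) * (if v \<in> C then x else y)"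
  have "sum ?g (C \<union> R) = sum ?g C + sum ?g R" by (rule sum.union_disjoint[OF fin disj])
  also have "sum ?g C = card C * ((if u \<in> C then 1 else 2) * x)" by simp
  also have "sum ?g R = card R * ((if u \<in> C then 2 else 1) * y)"
  proof -
    have "sum ?g R = (\<Sum>v\<in>R. (if u \<in> C then 2 else 1) * y)"
      using disj by (intro sum.cong) auto
    then show ?thesis by simp
  qed
  finally show ?thesis using eqs by auto
qed

text \<open>
  Merging two classes does not increase the least squared norm of a vector with given class sums.
\<close>

lemma sum_squares_over_parts:
  fixes P R s k :: real
  assumes "0 < s" "0 < k"
  shows "(P + R)\<^sup>2 / (s + k) \<le> P\<^sup>2 / s + R\<^sup>2 / k"
proof -
  have "P\<^sup>2 / s + R\<^sup>2 / k - (P + R)\<^sup>2 / (s + k) = (k * P - s * R)\<^sup>2 / (s * k * (s + k))"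
    using assms by (simp add: divide_simps) (simp add: power2_eq_square algebra_simps)
  moreover have "0 \<le> \<dots>" using assms by simp
  ultimately show ?thesis by linarith
qed

text \<open>
  The left-hand side is the quadratic form of the two-class kernel at a vector with sums \<open>P\<close> and
  \<open>R\<close> over the two classes, and \<open>P\<^sup>2 / p + R\<^sup>2 / m\<close> is the least squared norm of such a vector; so
  this is the Rayleigh bound for the eigenvalue \<open>\<kappa>\<close>.
  The difference of the two sides is a multiple of \<open>(m y P - p x R)\<^sup>2\<close>, which vanishes on the
  eigenvector.
\<close>

lemma two_class_form_bound:
  fixes p m x y \<kappa> P R :: real
  assumes "0 < p" "0 < m" "0 < x" "0 < y"
    and "p * x + 2 * m * y = \<kappa> * x" "2 * p * x + m * y = \<kappa> * y"
  shows "P\<^sup>2 + 4 * P * R + R\<^sup>2 \<le> \<kappa> * (P\<^sup>2 / p + R\<^sup>2 / m)"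
proof -
  have k1: "\<kappa> / p = 1 + 2 * m * y / (p * x)" and k2: "\<kappa> / m = 1 + 2 * p * x / (m * y)"
    using assms by (simp_all add: field_simps)
  have "\<kappa> * (P\<^sup>2 / p + R\<^sup>2 / m) = P\<^sup>2 * (\<kappa> / p) + R\<^sup>2 * (\<kappa> / m)" by (simp add: algebra_simps)
  also have "\<dots> - (P\<^sup>2 + 4 * P * R + R\<^sup>2) = 2 * (m * y * P - p * x * R)\<^sup>2 / (p * x * (m * y))"
    unfolding k1 k2 using assms(1-4) by (simp add: divide_simps) (simp add: power2_eq_square algebra_simps)
  finally have "\<kappa> * (P\<^sup>2 / p + R\<^sup>2 / m) - (P\<^sup>2 + 4 * P * R + R\<^sup>2) = \<dots>" .
  moreover have "0 \<le> 2 * (m * y * P - p * x * R)\<^sup>2 / (p * x * (m * y))" using assms(1-4) by simp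
  ultimately show ?thesis by linarith
qed

text \<open>
  The hypotheses \<open>g\<close> and \<open>d\<close> say that \<open>\<gamma>/\<beta>\<close> and \<open>\<delta>/\<alpha>\<close> cannot be small.  The latter always gives
  \<open>\<delta> \<ge> \<alpha>/3\<close>; the former gives \<open>\<gamma> > 2\<beta>/3\<close> provided that \<open>\<alpha> \<le> \<beta>\<close>.  These two ratios already add
  up to more than \<open>1\<close>.  The case \<open>\<alpha> > \<beta>\<close> follows from the symmetry that exchanges
  \<open>(\<alpha>, \<gamma>)\<close> with \<open>(\<beta>, \<delta>)\<close>.
\<close>

lemma class_sums_inequality:
  fixes \<alpha> \<beta> \<gamma> \<delta> :: real
  assumes pos: "0 < \<alpha>" "0 < \<beta>" "0 < \<gamma>" "0 < \<delta>"
    and le: "\<alpha> \<le> \<beta>"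
    and g: "\<beta> * (\<alpha> + 2 * \<beta> + \<gamma> + 2 / 3 * \<delta>) \<le> \<gamma> * (2 * \<alpha> + \<beta> + 2 * \<gamma> + \<delta>)"
    and d: "\<alpha> * (2 * \<alpha> + \<beta> + 2 / 3 * \<gamma> + \<delta>) \<le> \<delta> * (\<alpha> + 2 * \<beta> + \<gamma> + 2 * \<delta>)"
  shows "\<alpha> * \<beta> < \<alpha> * \<gamma> + \<beta> * \<delta> + \<gamma> * \<delta> / 3"
proof -
  have "2 / 3 * \<beta> < \<gamma>"
  proof (rule ccontr)
    assume "\<not> 2 / 3 * \<beta> < \<gamma>"
    then have gb: "\<gamma> \<le> 2 / 3 * \<beta>" by simp
    have "\<gamma> * (2 * \<alpha> + \<beta> + 2 * \<gamma> + \<delta>) \<le> 2 / 3 * \<beta> * (2 * \<alpha> + \<beta> + 2 * (2 / 3 * \<beta>) + \<delta>)"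
      using gb pos by (intro mult_mono) auto
    also have "\<dots> = \<beta> * (4 / 3 * \<alpha> + 14 / 9 * \<beta> + 2 / 3 * \<delta>)" by (simp add: algebra_simps)
    also have "\<dots> < \<beta> * (\<alpha> + 2 * \<beta> + \<gamma> + 2 / 3 * \<delta>)"
      using pos le by (intro mult_strict_left_mono) auto
    finally show False using g by simp
  qed
  moreover have "1 / 3 * \<alpha> \<le> \<delta>"
  proof (rule ccontr)
    assume "\<not> 1 / 3 * \<alpha> \<le> \<delta>"
    then have da: "\<delta> \<le> 1 / 3 * \<alpha>" by simp
    have "\<delta> * (\<alpha> + 2 * \<beta> + \<gamma> + 2 * \<delta>) \<le> 1 / 3 * \<alpha> * (\<alpha> + 2 * \<beta> + \<gamma> + 2 * (1 / 3 * \<alpha>))"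
      using da pos by (intro mult_mono) auto
    also have "\<dots> = \<alpha> * (5 / 9 * \<alpha> + 2 / 3 * \<beta> + 1 / 3 * \<gamma>)" by (simp add: algebra_simps)
    also have "\<dots> < \<alpha> * (2 * \<alpha> + \<beta> + 2 / 3 * \<gamma> + \<delta>)"
      using pos by (intro mult_strict_left_mono) auto
    finally show False using d by simp
  qed
  ultimately have "\<alpha> * (2 / 3 * \<beta>) + \<beta> * (1 / 3 * \<alpha>) < \<alpha> * \<gamma> + \<beta> * \<delta>"
    using pos by (intro add_less_le_mono mult_strict_left_mono mult_left_mono) auto
  moreover have "0 < \<gamma> * \<delta>" using pos by simp
  ultimately show ?thesis by simp
qed

text \<open>
  Here \<open>s\<close>, \<open>t\<close>, \<open>k\<close>, \<open>l\<close> are the sizes of the classes \<open>A\<close>, \<open>B\<close>, \<open>U - A\<close>, \<open>V - B\<close>, the eigenvector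
  of the four-class kernel takes the values \<open>a\<close>, \<open>b\<close>, \<open>c\<close>, \<open>d\<close> on them, and \<open>\<kappa>\<close> is the eigenvalue
  of the complete bipartite graph with parts \<open>A \<union> B\<close> and \<open>(U - A) \<union> (V - B)\<close>.  The inequality
  compares the two quadratic forms at the four-class eigenvector.
\<close>

lemma four_class_eigenvalue_less:
  fixes a b c d s t k l \<theta> \<kappa> x y :: real
  assumes pos: "0 < a" "0 < b" "0 < c" "0 < d" "0 < s" "0 < t" "0 < \<theta>"
    and kt: "t \<le> k" and ls: "s \<le> l"
    and ea: "s * a + 2 * t * b + k * c + 2 * l * d = \<theta> * a"
    and eb: "2 * s * a + t * b + 2 * k * c + l * d = \<theta> * b"
    and ec: "s * a + 2 * t * b + k * c + 2 / 3 * l * d = \<theta> * c"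
    and ed: "2 * s * a + t * b + 2 / 3 * k * c + l * d = \<theta> * d"
    and xy: "0 < x" "0 < y"
    and ex: "(s + t) * x + 2 * (k + l) * y = \<kappa> * x"
    and ey: "2 * (s + t) * x + (k + l) * y = \<kappa> * y"
  shows "\<theta> < \<kappa>"
proof -
  define \<alpha> \<beta> \<gamma> \<delta> where defs: "\<alpha> = s * a" "\<beta> = t * b" "\<gamma> = k * c" "\<delta> = l * d"
  have k: "0 < k" and l: "0 < l" using pos kt ls by auto
  have sums_pos: "0 < \<alpha>" "0 < \<beta>" "0 < \<gamma>" "0 < \<delta>" using pos k l by (simp_all add: defs)
  note eqs = ea[folded defs, unfolded mult.assoc, folded defs] eb[unfolded mult.assoc, folded defs]
    ec[unfolded mult.assoc, folded defs] ed[unfolded mult.assoc, folded defs]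
  \<comment> \<open>As \<open>\<beta> = t b\<close> and \<open>\<gamma> = k c\<close>, this is \<open>\<beta> (\<theta> c) \<le> \<gamma> (\<theta> b)\<close>, which holds since \<open>t \<le> k\<close>.\<close>
  have g: "\<beta> * (\<alpha> + 2 * \<beta> + \<gamma> + 2 / 3 * \<delta>) \<le> \<gamma> * (2 * \<alpha> + \<beta> + 2 * \<gamma> + \<delta>)"
  proof -
    have "\<beta> * (\<theta> * c) = t * (b * c * \<theta>)" by (simp add: defs)
    also have "\<dots> \<le> k * (b * c * \<theta>)" using kt pos by (intro mult_right_mono) auto
    also have "\<dots> = \<gamma> * (\<theta> * b)" by (simp add: defs)
    finally show ?thesis using eqs(2,3) by (simp add: algebra_simps)
  qed
  have d: "\<alpha> * (2 * \<alpha> + \<beta> + 2 / 3 * \<gamma> + \<delta>) \<le> \<delta> * (\<alpha> + 2 * \<beta> + \<gamma> + 2 * \<delta>)"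
  proof -
    have "\<alpha> * (\<theta> * d) = s * (a * d * \<theta>)" by (simp add: defs)
    also have "\<dots> \<le> l * (a * d * \<theta>)" using ls pos by (intro mult_right_mono) auto
    also have "\<dots> = \<delta> * (\<theta> * a)" by (simp add: defs)
    finally show ?thesis using eqs(1,4) by (simp add: algebra_simps)
  qed
  have key: "\<alpha> * \<beta> < \<alpha> * \<gamma> + \<beta> * \<delta> + \<gamma> * \<delta> / 3"
  proof (cases "\<alpha> \<le> \<beta>")
    case True
    show ?thesis by (rule class_sums_inequality[OF sums_pos True g d])
  next
    case False
    then have "\<beta> * \<alpha> < \<beta> * \<delta> + \<alpha> * \<gamma> + \<delta> * \<gamma> / 3"
      using g d sums_pos by (intro class_sums_inequality) (auto simp: algebra_simps)
    then show ?thesis by (simp add: algebra_simps)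
  qed
  \<comment> \<open>The squared norm of the four-class eigenvector, written in terms of its class sums.\<close>
  define N where "N = \<alpha>\<^sup>2 / s + \<beta>\<^sup>2 / t + (\<gamma>\<^sup>2 / k + \<delta>\<^sup>2 / l)"
  have N_eq: "N = \<alpha> * a + \<beta> * b + \<gamma> * c + \<delta> * d"
    using pos k l by (simp add: N_def defs power2_eq_square)
  have N: "0 < N" using pos sums_pos unfolding N_eq by (auto intro!: add_pos_pos)
  have kappa: "0 < \<kappa>"
  proof -
    have "0 < (s + t) * x + 2 * (k + l) * y" using pos k l xy by (auto intro!: add_pos_pos)
    then show ?thesis using ex xy by (simp add: zero_less_mult_iff)
  qed
  have "\<theta> * N = \<alpha> * (\<theta> * a) + \<beta> * (\<theta> * b) + \<gamma> * (\<theta> * c) + \<delta> * (\<theta> * d)"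
    by (simp add: N_eq algebra_simps)
  also have "\<dots> = (\<alpha> + \<beta>)\<^sup>2 + 4 * (\<alpha> + \<beta>) * (\<gamma> + \<delta>) + (\<gamma> + \<delta>)\<^sup>2
      - 2 * (\<alpha> * \<gamma> + \<beta> * \<delta> + \<gamma> * \<delta> / 3 - \<alpha> * \<beta>)"
    unfolding eqs[symmetric] by (simp add: power2_eq_square algebra_simps)
  also have "\<dots> < (\<alpha> + \<beta>)\<^sup>2 + 4 * (\<alpha> + \<beta>) * (\<gamma> + \<delta>) + (\<gamma> + \<delta>)\<^sup>2"
    using key by simp
  also have "\<dots> \<le> \<kappa> * ((\<alpha> + \<beta>)\<^sup>2 / (s + t) + (\<gamma> + \<delta>)\<^sup>2 / (k + l))"
    using pos k l xy ex ey by (intro two_class_form_bound[where x = x and y = y]) auto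
  also have "\<dots> \<le> \<kappa> * N"
    unfolding N_def using pos k l kappa
    by (intro mult_left_mono add_mono sum_squares_over_parts) auto
  finally show ?thesis using N by simp
qed

section \<open>The theorems of Hall and Koenig\<close>

text \<open>
  Rado's proof: shrink the sets as long as Hall's condition permits.  If some \<open>A i\<close> has two elements
  \<open>x \<noteq> y\<close> neither of which can be removed, two index sets \<open>J\<close>, \<open>K\<close> witness this, and counting the
  union and the intersection of the two violating sets contradicts Hall's condition for
  \<open>J \<union> K \<union> {i}\<close> and \<open>J \<inter> K\<close>.  If all sets are singletons, the choice is forced and the condition
  for pairs makes it injective.
\<close>

lemma hall_marriage:
  fixes A :: "'i \<Rightarrow> 'b set"
  assumes "finite I" "\<And>i. i \<in> I \<Longrightarrow> finite (A i)"
    and "\<And>J. J \<subseteq> I \<Longrightarrow> card J \<le> card (\<Union>(A ` J))"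
  shows "\<exists>f. inj_on f I \<and> (\<forall>i\<in>I. f i \<in> A i)"
  using assms(2,3)
proof (induction "\<Sum>i\<in>I. card (A i)" arbitrary: A rule: less_induct)
  case less
  note fin = less.prems(1) and hall = less.prems(2)
  show ?case
  proof (cases "\<forall>i\<in>I. card (A i) \<le> 1")
    case True
    have one: "\<exists>y. A i = {y}" if "i \<in> I" for i
    proof -
      have "card (A i) = 1" using hall[of "{i}"] True that by (auto intro: le_antisym)
      then show ?thesis by (auto simp: card_1_singleton_iff)
    qed
    then obtain f where f: "\<And>i. i \<in> I \<Longrightarrow> A i = {f i}" by metis
    have "inj_on f I"
    proof
      fix i j assume ij: "i \<in> I" "j \<in> I" "f i = f j"
      then have "\<Union>(A ` {i, j}) = {f i}" using f by auto
      moreover have "card {i, j} \<le> card (\<Union>(A ` {i, j}))" using ij by (intro hall) auto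
      ultimately have "card {i, j} \<le> 1" by simp
      then show "i = j" by (cases "i = j") auto
    qed
    with f show ?thesis by auto
  next
    case False
    then obtain i where i: "i \<in> I" "\<not> card (A i) \<le> 1" by auto
    then obtain x y where xy: "x \<in> A i" "y \<in> A i" "x \<noteq> y"
      using fin[OF i(1)] by (auto simp: card_le_Suc0_iff_eq)
    have drop: "?thesis \<or> (\<exists>J \<subseteq> I - {i}. card (\<Union>(A ` J) \<union> (A i - {u})) \<le> card J)"
      if u: "u \<in> A i" for u
    proof (cases "\<forall>J\<subseteq>I. card J \<le> card (\<Union>((A(i := A i - {u})) ` J))")
      case True
      have "(\<Sum>j\<in>I. card ((A(i := A i - {u})) j)) < (\<Sum>j\<in>I. card (A j))"
        using i(1) card_Diff1_less[OF fin[OF i(1)] u] assms(1)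
        by (intro sum_strict_mono_ex1) (auto intro!: bexI[of _ i] simp del: card_Diff_insert)
      moreover have "finite ((A(i := A i - {u})) j)" if "j \<in> I" for j
        using fin[OF that] fin[OF i(1)] by simp
      ultimately have "\<exists>f. inj_on f I \<and> (\<forall>j\<in>I. f j \<in> (A(i := A i - {u})) j)"
        using True by (intro less.hyps) blast+
      then show ?thesis by (metis DiffD1 fun_upd_apply)
    next
      case False
      then obtain J where J: "J \<subseteq> I" "card (\<Union>((A(i := A i - {u})) ` J)) < card J" by auto
      have finJ: "finite J" using J(1) assms(1) finite_subset by blast
      have iJ: "i \<in> J"
      proof (rule ccontr)
        assume "i \<notin> J"
        then have "\<Union>((A(i := A i - {u})) ` J) = \<Union>(A ` J)" by (auto split: if_splits)
        then show False using J hall[OF J(1)] by simp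
      qed
      have "\<Union>((A(i := A i - {u})) ` J) = \<Union>(A ` (J - {i})) \<union> (A i - {u})"
        using iJ by (auto split: if_splits)
      then have "card (\<Union>(A ` (J - {i})) \<union> (A i - {u})) \<le> card (J - {i})"
        using J iJ finJ by simp
      then show ?thesis using J(1) by blast
    qed
    show ?thesis
    proof (rule ccontr)
      assume no: "\<not> ?thesis"
      obtain J where J: "J \<subseteq> I - {i}" "card (\<Union>(A ` J) \<union> (A i - {x})) \<le> card J"
        using drop[OF xy(1)] no by blast
      obtain K where K: "K \<subseteq> I - {i}" "card (\<Union>(A ` K) \<union> (A i - {y})) \<le> card K"
        using drop[OF xy(2)] no by blast
      let ?P = "\<Union>(A ` J) \<union> (A i - {x})" and ?Q = "\<Union>(A ` K) \<union> (A i - {y})"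
      have finJK: "finite J" "finite K" using J K assms(1) finite_subset by blast+
      have finPQ: "finite ?P" "finite ?Q"
        using fin finJK J(1) K(1) i(1) by (blast intro: finite_UN_I finite_Diff)+
      have sub: "insert i (J \<union> K) \<subseteq> I" "J \<inter> K \<subseteq> I" using J K i by auto
      have "card (J \<union> K) + 1 = card (insert i (J \<union> K))"
        using J(1) K(1) finJK by (subst card_insert_disjoint) auto
      also have "\<dots> \<le> card (\<Union>(A ` insert i (J \<union> K)))" by (rule hall[OF sub(1)])
      also have "\<dots> \<le> card (?P \<union> ?Q)" using finPQ xy by (intro card_mono) auto
      finally have un: "card (J \<union> K) + 1 \<le> card (?P \<union> ?Q)" .
      have "card (J \<inter> K) \<le> card (\<Union>(A ` (J \<inter> K)))" by (rule hall[OF sub(2)])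
      also have "\<dots> \<le> card (?P \<inter> ?Q)" using finPQ by (intro card_mono) auto
      finally have "card (J \<inter> K) \<le> card (?P \<inter> ?Q)" .
      with un have "card J + card K + 1 \<le> card ?P + card ?Q"
        using card_Un_Int[OF finPQ] card_Un_Int[OF finJK] by linarith
      with J(2) K(2) show False by simp
    qed
  qed
qed

text \<open>
  Hall's condition holds for \<open>A\<close> and the neighbours outside the cover: if a set \<open>J \<subseteq> A\<close> had too few
  of them, replacing \<open>J\<close> by these neighbours would give a smaller cover.
\<close>

lemma minimal_cover_saturated:
  assumes fin: "finite U" "finite V" and A: "A \<subseteq> U" and B: "B \<subseteq> V" and E: "E \<subseteq> U \<times> V"
    and cover: "\<And>x y. (x, y) \<in> E \<Longrightarrow> x \<in> A \<or> y \<in> B"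
    and minimal: "\<And>A' B'. \<lbrakk>A' \<subseteq> U; B' \<subseteq> V; \<And>x y. (x, y) \<in> E \<Longrightarrow> x \<in> A' \<or> y \<in> B'\<rbrakk>
      \<Longrightarrow> card A + card B \<le> card A' + card B'"
  shows "\<exists>f. inj_on f A \<and> (\<forall>x\<in>A. f x \<in> V - B \<and> (x, f x) \<in> E)"
proof -
  define N where "N x = {y \<in> V - B. (x, y) \<in> E}" for x
  have finA: "finite A" "finite B" using A B fin finite_subset by blast+
  have "\<exists>f. inj_on f A \<and> (\<forall>x\<in>A. f x \<in> N x)"
  proof (rule hall_marriage)
    fix J assume J: "J \<subseteq> A"
    have sub: "\<Union>(N ` J) \<subseteq> V - B" by (auto simp: N_def)
    then have finN: "finite (\<Union>(N ` J))" using fin(2) finite_subset by blast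
    have "card A + card B \<le> card (A - J) + card (B \<union> \<Union>(N ` J))"
    proof (rule minimal)
      show "x \<in> A - J \<or> y \<in> B \<union> \<Union>(N ` J)" if "(x, y) \<in> E" for x y
        using cover[OF that] that E by (auto simp: N_def)
    qed (use A B sub in auto)
    also have "card (B \<union> \<Union>(N ` J)) = card B + card (\<Union>(N ` J))"
      using sub finN finA by (intro card_Un_disjoint) auto
    also have "card (A - J) = card A - card J"
      using J finA(1) finite_subset by (intro card_Diff_subset) auto
    finally show "card J \<le> card (\<Union>(N ` J))" using card_mono[OF finA(1) J] by simp
  qed (use finA fin in \<open>auto simp: N_def\<close>)
  then show ?thesis by (auto simp: N_def)
qed

lemma matching_card_le_cover:
  assumes fin: "finite C" and M: "matching G M"
    and cover: "\<And>x y. (x, y) \<in> parcs G \<Longrightarrow> x \<in> C \<or> y \<in> C"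
  shows "card M \<le> card C"
proof -
  have "\<exists>x. x \<in> e \<and> x \<in> C" if "e \<in> M" for e
  proof -
    obtain x y where "e = {x, y}" "(x, y) \<in> parcs G"
      using M \<open>e \<in> M\<close> unfolding matching_def edges_def by blast
    then show ?thesis using cover[of x y] by auto
  qed
  then obtain h where h: "\<And>e. e \<in> M \<Longrightarrow> h e \<in> e \<and> h e \<in> C" by metis
  have "inj_on h M"
  proof
    fix e f assume "e \<in> M" "f \<in> M" "h e = h f"
    then have "h e \<in> e \<inter> f" using h by (metis IntI)
    then show "e = f" using M \<open>e \<in> M\<close> \<open>f \<in> M\<close> by (auto simp: matching_def)
  qed
  then show ?thesis using h fin by (intro card_inj_on_le[of h]) auto
qed

text \<open>
  A minimum cover \<open>A \<union> B\<close> is saturated on both sides, \<open>A\<close> by a matching into \<open>V - B\<close> and \<open>B\<close> by one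
  into \<open>U - A\<close>.  The two matchings are disjoint, and together they have as many edges as the cover
  has vertices.
\<close>

lemma koenig:
  assumes G: "pair_graph G"
    and bip: "pverts G = U \<union> V" "U \<inter> V = {}" "parcs G \<subseteq> U \<times> V \<union> V \<times> U"
  obtains A B where "A \<subseteq> U" "B \<subseteq> V" "\<And>x y. (x, y) \<in> parcs G \<Longrightarrow> x \<in> A \<union> B \<or> y \<in> A \<union> B"
    "card A + card B = matching_number G" "card A \<le> card (V - B)" "card B \<le> card (U - A)"
proof -
  interpret pair_graph G by (rule G)
  have fin: "finite U" "finite V" using pair_finite_verts bip(1) by auto
  define E where "E = parcs G \<inter> U \<times> V"
  define cov where "cov = (\<lambda>(A, B). A \<subseteq> U \<and> B \<subseteq> V \<and> (\<forall>(x, y)\<in>E. x \<in> A \<or> y \<in> B))"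
  have "cov (U, V)" by (auto simp: cov_def E_def)
  from ex_has_least_nat[of cov, OF this, of "\<lambda>(A, B). card A + card B"]
  obtain A B where AB: "cov (A, B)"
    and min: "\<And>A' B'. cov (A', B') \<Longrightarrow> card A + card B \<le> card A' + card B'"
    by auto
  have A: "A \<subseteq> U" and B: "B \<subseteq> V" and cE: "\<And>x y. (x, y) \<in> E \<Longrightarrow> x \<in> A \<or> y \<in> B"
    using AB by (auto simp: cov_def)
  have finAB: "finite A" "finite B" using A B fin finite_subset by blast+
  have disj: "A \<inter> B = {}" using A B bip(2) by auto
  let ?C = "A \<union> B"
  have cover: "x \<in> ?C \<or> y \<in> ?C" if "(x, y) \<in> parcs G" for x y
  proof -
    have "(x, y) \<in> E \<or> (y, x) \<in> E" using that bip(3) arcs_symmetric by (auto simp: E_def)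
    then show ?thesis using cE by auto
  qed
  obtain f where f: "inj_on f A" "\<And>x. x \<in> A \<Longrightarrow> f x \<in> V - B \<and> (x, f x) \<in> E"
  proof -
    have "\<exists>f. inj_on f A \<and> (\<forall>x\<in>A. f x \<in> V - B \<and> (x, f x) \<in> E)"
    proof (rule minimal_cover_saturated[OF fin A B])
      show "card A + card B \<le> card A' + card B'"
        if "A' \<subseteq> U" "B' \<subseteq> V" "\<And>x y. (x, y) \<in> E \<Longrightarrow> x \<in> A' \<or> y \<in> B'" for A' B'
        using min[of A' B'] that by (force simp: cov_def)
    qed (use cE in \<open>auto simp: E_def\<close>)
    then show thesis using that by auto
  qed
  obtain g where g: "inj_on g B" "\<And>y. y \<in> B \<Longrightarrow> g y \<in> U - A \<and> (g y, y) \<in> E"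
  proof -
    have "\<exists>g. inj_on g B \<and> (\<forall>y\<in>B. g y \<in> U - A \<and> (y, g y) \<in> E\<inverse>)"
    proof (rule minimal_cover_saturated[OF fin(2,1) B A])
      show "card B + card A \<le> card B' + card A'"
        if "B' \<subseteq> V" "A' \<subseteq> U" "\<And>x y. (x, y) \<in> E\<inverse> \<Longrightarrow> x \<in> B' \<or> y \<in> A'" for A' B'
        using min[of A' B'] that by (force simp: cov_def)
    qed (use cE in \<open>auto simp: E_def\<close>)
    then show thesis using that by auto
  qed
  \<comment> \<open>The partner of each vertex of the cover; no partner belongs to the cover.\<close>
  define h where "h x = (if x \<in> A then f x else g x)" for x
  have h_out: "h x \<notin> ?C" and h_edge: "{x, h x} \<in> edges G" if "x \<in> ?C" for x
    using that f(2)[of x] g(2)[of x] A B bip(2) by (auto simp: h_def edges_def E_def insert_commute)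
  have h_inj: "inj_on h ?C"
  proof
    fix x y assume xy: "x \<in> ?C" "y \<in> ?C" "h x = h y"
    have "f u \<noteq> g v" if "u \<in> A" "v \<in> B" for u v
      using f(2)[OF that(1)] g(2)[OF that(2)] bip(2) by auto
    then have same: "x \<in> A \<longleftrightarrow> y \<in> A" using xy unfolding h_def by (metis UnE)
    show "x = y"
    proof (cases "x \<in> A")
      case True
      then have "f x = f y" using xy(3) same by (simp add: h_def)
      then show ?thesis using inj_onD[OF f(1)] True same by blast
    next
      case False
      then have "g x = g y" using xy(3) same by (simp add: h_def)
      moreover have "x \<in> B" "y \<in> B" using xy(1,2) False same by auto
      ultimately show ?thesis by (rule inj_onD[OF g(1)])
    qed
  qed
  let ?M = "(\<lambda>x. {x, h x}) ` ?C"
  have meet: "x = y" if "x \<in> ?C" "y \<in> ?C" "{x, h x} \<inter> {y, h y} \<noteq> {}" for x y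
  proof -
    have "h y \<noteq> x" "h x \<noteq> y" using h_out that(1,2) by metis+
    then have "x = y \<or> h x = h y" using that(3) by auto
    then show ?thesis using inj_onD[OF h_inj] that(1,2) by blast
  qed
  have M: "matching G ?M"
    unfolding matching_def
  proof (intro conjI ballI impI)
    show "?M \<subseteq> edges G" using h_edge by (rule image_subsetI)
    fix e e' assume "e \<in> ?M" "e' \<in> ?M" and ne: "e \<noteq> e'"
    then obtain x y where xy: "x \<in> ?C" "e = {x, h x}" "y \<in> ?C" "e' = {y, h y}" by auto
    then have "x \<noteq> y" using ne by auto
    then show "e \<inter> e' = {}" using meet[OF xy(1,3)] unfolding xy(2,4) by argo
  qed
  have "inj_on (\<lambda>x. {x, h x}) ?C"
  proof
    fix x y assume "x \<in> ?C" "y \<in> ?C" "{x, h x} = {y, h y}"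
    then show "x = y" by (intro meet) simp_all
  qed
  then have "card ?M = card ?C" by (rule card_image)
  also have "\<dots> = card A + card B" using finAB disj by (intro card_Un_disjoint)
  finally have cardM: "card ?M = card A + card B" .
  have le: "card M' \<le> card A + card B" if "matching G M'" for M'
    using matching_card_le_cover[OF _ that cover] finAB card_Un_disjoint[OF finAB disj] by auto
  have "matching_number G = card A + card B"
    unfolding matching_number_def
  proof (rule Max_eqI)
    show "finite {card M |M. matching G M}"
      using le by (intro finite_subset[OF _ finite_atMost[of "card A + card B"]]) auto
    show "card A + card B \<in> {card M |M. matching G M}" using M cardM by force
  qed (use le in auto)
  moreover have "card A \<le> card (V - B)" using f fin by (intro card_inj_on_le[of f]) auto
  moreover have "card B \<le> card (U - A)" using g fin by (intro card_inj_on_le[of g]) auto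
  ultimately show thesis using A B cover by (intro that) auto
qed

section \<open>The Harary spectral radius as an eigenvalue on the vertices\<close>

text \<open>
  The kernel of \<open>2 RD(G) + I\<close>.  In a bipartite graph it has the same bound \<open>1\<close> between any two
  vertices of the same side, equal or not, so that kernels depending only on the classes of the
  vertices dominate it.
\<close>

definition shifted_harary :: "'a pair_pre_digraph \<Rightarrow> 'a \<Rightarrow> 'a \<Rightarrow> real" where
  "shifted_harary G x y = (if x = y then 1 else 2 / real (graph_dist G x y))"

lemma obtains_vertex_numbering:
  assumes "finite (pverts G)"
  obtains vs where "vertex_numbering G vs" "length vs = card (pverts G)"
  using finite_distinct_list[OF assms] by (metis distinct_card vertex_numbering_def)

lemma harary_matrix_mult_vec:
  assumes "i < length vs" "v \<in> carrier_vec (length vs)"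
  shows "(map_mat complex_of_real (harary_matrix G vs) *\<^sub>v v) $ i
    = (\<Sum>j<length vs. complex_of_real (if i = j then 0 else 1 / graph_dist G (vs ! i) (vs ! j)) * v $ j)"
  using assms by (auto simp: harary_matrix_def scalar_prod_def lessThan_atLeast0 intro!: sum.cong)

text \<open>
  The vector consists of the moduli of the entries of a complex eigenvector for an eigenvalue of
  maximal modulus; the inequality is the triangle inequality.
\<close>

lemma harary_spectral_radius_subinvariant:
  assumes fin: "finite (pverts G)" and ne: "pverts G \<noteq> {}"
  obtains w v where "\<And>x. 0 \<le> w x" "v \<in> pverts G" "w v \<noteq> 0"
    "\<And>x. x \<in> pverts G \<Longrightarrow>
      (2 * harary_spectral_radius G + 1) * w x \<le> (\<Sum>y\<in>pverts G. shifted_harary G x y * w y)"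
proof -
  obtain vs where vs: "vertex_numbering G vs" and len: "length vs = card (pverts G)"
    using obtains_vertex_numbering[OF fin] .
  let ?n = "length vs"
  let ?A = "map_mat complex_of_real (harary_matrix G vs)"
  have A: "?A \<in> carrier_mat ?n ?n" by (simp add: harary_matrix_def)
  have d: "distinct vs" "set vs = pverts G" using vs by (auto simp: vertex_numbering_def)
  have bij: "bij_betw ((!) vs) {..<?n} (pverts G)"
    using d by (simp add: bij_betw_nth)
  have "harary_spectral_radius G \<in> norm ` spectrum ?A"
    unfolding harary_spectral_radius_eq[OF vs]
    using fin ne len by (intro spectral_radius_mem_max(1)[OF A]) (auto simp: card_gt_0_iff)
  then obtain k where k: "harary_spectral_radius G = norm k" "eigenvalue ?A k"
    by (auto simp: spectrum_def)
  then obtain u where u: "u \<in> carrier_vec ?n" "u \<noteq> 0\<^sub>v ?n" "?A *\<^sub>v u = k \<cdot>\<^sub>v u"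
    by (auto simp: eigenvalue_def eigenvector_def harary_matrix_def)
  define w where "w x = norm (u $ (the_inv_into {..<?n} ((!) vs) x))" for x
  have w_nth: "w (vs ! i) = norm (u $ i)" if "i < ?n" for i
    using that bij by (simp add: w_def the_inv_into_f_f bij_betw_def)
  obtain i0 where i0: "i0 < ?n" "u $ i0 \<noteq> 0"
    using u(1,2) by (metis carrier_vecD eq_vecI index_zero_vec)
  show thesis
  proof (rule that)
    show "0 \<le> w x" for x by (simp add: w_def)
    show "vs ! i0 \<in> pverts G" using nth_mem[OF i0(1)] d(2) by simp
    show "w (vs ! i0) \<noteq> 0" using i0 w_nth by simp
    fix x assume "x \<in> pverts G"
    then obtain i where i: "i < ?n" "x = vs ! i" using d by (metis in_set_conv_nth)
    let ?h = "\<lambda>j. if i = j then 0 else 1 / real (graph_dist G (vs ! i) (vs ! j))"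
    have row: "k * u $ i = (\<Sum>j<?n. complex_of_real (?h j) * u $ j)"
      using harary_matrix_mult_vec[OF i(1) u(1), of G] u(1,3) i(1) by simp
    have "norm k * w x = norm (\<Sum>j<?n. complex_of_real (?h j) * u $ j)"
      unfolding row[symmetric] using w_nth[OF i(1)] i(2) by (simp add: norm_mult)
    also have "\<dots> \<le> (\<Sum>j<?n. ?h j * norm (u $ j))"
      by (rule order_trans[OF norm_sum]) (auto simp: norm_mult norm_divide intro!: sum_mono)
    finally have "(2 * norm k + 1) * w x \<le> (\<Sum>j<?n. 2 * (?h j * norm (u $ j))) + norm (u $ i)"
      using i w_nth[OF i(1)] by (simp add: algebra_simps flip: sum_distrib_left)
    also have "norm (u $ i) = (\<Sum>j<?n. if i = j then norm (u $ j) else 0)"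
      using i(1) by simp
    also have "(\<Sum>j<?n. 2 * (?h j * norm (u $ j))) + \<dots>
        = (\<Sum>j<?n. shifted_harary G x (vs ! j) * w (vs ! j))"
      unfolding sum.distrib[symmetric]
      using i w_nth d(1) by (intro sum.cong) (auto simp: shifted_harary_def nth_eq_iff_index_eq)
    also have "\<dots> = (\<Sum>y\<in>pverts G. shifted_harary G x y * w y)"
      by (rule sum.reindex_bij_betw[OF bij])
    finally show "(2 * harary_spectral_radius G + 1) * w x \<le> \<dots>" by (simp add: k(1))
  qed
qed

lemma shifted_eigenvalue_le_harary_spectral_radius:
  assumes fin: "finite (pverts G)"
    and f: "v \<in> pverts G" "f v \<noteq> 0"
    and eq: "\<And>x. x \<in> pverts G \<Longrightarrow> (\<Sum>y\<in>pverts G. shifted_harary G x y * f y) = \<theta> * f x"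
  shows "\<theta> \<le> 2 * harary_spectral_radius G + 1"
proof -
  obtain vs where vs: "vertex_numbering G vs" and len: "length vs = card (pverts G)"
    using obtains_vertex_numbering[OF fin] .
  let ?n = "length vs"
  let ?A = "map_mat complex_of_real (harary_matrix G vs)"
  let ?k = "complex_of_real ((\<theta> - 1) / 2)"
  let ?u = "vec ?n (\<lambda>i. complex_of_real (f (vs ! i)))"
  have A: "?A \<in> carrier_mat ?n ?n" by (simp add: harary_matrix_def)
  have d: "distinct vs" "set vs = pverts G" using vs by (auto simp: vertex_numbering_def)
  have bij: "bij_betw ((!) vs) {..<?n} (pverts G)"
    using d by (simp add: bij_betw_nth)
  have "?A *\<^sub>v ?u = ?k \<cdot>\<^sub>v ?u"
  proof (intro eq_vecI)
    fix i assume "i < dim_vec (?k \<cdot>\<^sub>v ?u)"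
    then have i: "i < ?n" by simp
    let ?h = "\<lambda>j. if i = j then 0 else 1 / real (graph_dist G (vs ! i) (vs ! j))"
    have "\<theta> * f (vs ! i) = (\<Sum>y\<in>pverts G. shifted_harary G (vs ! i) y * f y)"
      using nth_mem[OF i] d(2) by (intro eq[symmetric]) simp
    also have "\<dots> = (\<Sum>j<?n. shifted_harary G (vs ! i) (vs ! j) * f (vs ! j))"
      by (rule sum.reindex_bij_betw[OF bij, symmetric])
    also have "\<dots> = (\<Sum>j<?n. 2 * (?h j * f (vs ! j)) + (if i = j then f (vs ! j) else 0))"
      using i d(1) by (intro sum.cong) (auto simp: shifted_harary_def nth_eq_iff_index_eq)
    also have "\<dots> = 2 * (\<Sum>j<?n. ?h j * f (vs ! j)) + f (vs ! i)"
      using i by (simp add: sum.distrib sum_distrib_left)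
    finally have "(\<Sum>j<?n. ?h j * f (vs ! j)) = (\<theta> - 1) / 2 * f (vs ! i)" by (simp add: field_simps)
    then have "complex_of_real (\<Sum>j<?n. ?h j * f (vs ! j)) = ?k * complex_of_real (f (vs ! i))"
      by (simp only: of_real_mult)
    then show "(?A *\<^sub>v ?u) $ i = (?k \<cdot>\<^sub>v ?u) $ i"
      using harary_matrix_mult_vec[OF i, of ?u G] i
      by (simp only: of_real_sum of_real_mult vec_carrier index_vec index_smult_vec dim_vec) simp
  qed (simp add: harary_matrix_def)
  moreover have "?u \<noteq> 0\<^sub>v ?n"
  proof
    obtain i where i: "i < ?n" "vs ! i = v" using f(1) d by (metis in_set_conv_nth)
    assume "?u = 0\<^sub>v ?n"
    then have "?u $ i = 0" using i by simp
    then show False using i f(2) by simp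
  qed
  ultimately have "?k \<in> spectrum ?A"
    by (auto simp: spectrum_def eigenvalue_def eigenvector_def harary_matrix_def intro!: exI[of _ ?u])
  then have "norm ?k \<le> harary_spectral_radius G"
    unfolding harary_spectral_radius_eq[OF vs]
    using f(1) d(2) by (intro spectral_radius_mem_max(2)[OF A] imageI) auto
  then have "(\<theta> - 1) / 2 \<le> harary_spectral_radius G" by (simp add: norm_of_real del: of_real_divide)
  then show ?thesis by simp
qed

section \<open>Distances in bipartite graphs\<close>

lemma graph_dist_le:
  assumes "pre_digraph.apath (with_proj G) x q y"
  shows "graph_dist G x y \<le> length q"
  unfolding graph_dist_def using assms by (intro Least_le) auto

lemma graph_dist_attained:
  assumes "pre_digraph.apath (with_proj G) x q y"
  obtains r where "pre_digraph.awalk (with_proj G) x r y" "length r = graph_dist G x y"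
proof -
  have "\<exists>k r. pre_digraph.apath (with_proj G) x r y \<and> length r = k" using assms by blast
  from LeastI_ex[OF this] show thesis
    using that unfolding graph_dist_def pre_digraph.apath_def by blast
qed

lemma connected_apath:
  assumes G: "pair_graph G" and conn: "Digraph_Component.connected (with_proj G)"
    and x: "x \<in> pverts G" "y \<in> pverts G"
  obtains q where "pre_digraph.apath (with_proj G) x q y"
proof -
  interpret pair_graph G by (rule G)
  have "x \<rightarrow>\<^sup>*\<^bsub>with_proj G\<^esub> y"
    using symmetric_connected_imp_strongly_connected[OF sym_arcs conn] x
    unfolding strongly_connected_def by simp
  then obtain p where "awalk x p y" unfolding reachable_awalk ..
  then show thesis by (rule that[OF apath_awalk_to_apath])
qed

text \<open>
  Vertices of one side have distance at least \<open>2\<close>, and vertices of different sides that are not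
  adjacent have distance at least \<open>3\<close>.  Connectedness matters because \<open>graph_dist\<close> has no useful
  value without a path.
\<close>

lemma shifted_harary_le:
  assumes G: "pair_graph G" and conn: "Digraph_Component.connected (with_proj G)"
    and bip: "U \<inter> V = {}" "pverts G = U \<union> V" "parcs G \<subseteq> U \<times> V \<union> V \<times> U"
    and xy: "x \<in> pverts G" "y \<in> pverts G"
  shows "shifted_harary G x y \<le> 2"
    and "x \<in> U \<longleftrightarrow> y \<in> U \<Longrightarrow> shifted_harary G x y \<le> 1"
    and "\<lbrakk>x \<in> U \<longleftrightarrow> y \<notin> U; (x, y) \<notin> parcs G\<rbrakk> \<Longrightarrow> shifted_harary G x y \<le> 2 / 3"
proof -
  interpret pair_graph G by (rule G)
  obtain q where q: "awalk x q y" "length q = graph_dist G x y"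
    using connected_apath[OF G conn xy] graph_dist_attained[of G x _ y] by blast
  have bound: "shifted_harary G x y \<le> 2 / real k" if "x \<noteq> y" "k \<le> graph_dist G x y" "0 < k" for k
    using that by (simp add: shifted_harary_def frac_le)
  have 1: "0 < graph_dist G x y" if "x \<noteq> y"
    using q that by (cases q) (auto simp: awalk_simps)
  have 2: "2 \<le> graph_dist G x y" if "x \<noteq> y" "(x, y) \<notin> parcs G"
  proof (rule ccontr)
    assume "\<not> 2 \<le> graph_dist G x y"
    then have "length q = 1" using q(2) 1 that(1) by simp
    then obtain e where "q = [e]" by (auto simp: length_Suc_conv)
    then show False using q(1) that by (cases e) (auto simp: awalk_simps)
  qed
  have 3: "3 \<le> graph_dist G x y" if "x \<in> U \<longleftrightarrow> y \<notin> U" "(x, y) \<notin> parcs G"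
  proof (rule ccontr)
    assume "\<not> 3 \<le> graph_dist G x y"
    then have "length q = 2" using q(2) 2 that by force
    then obtain e f where "q = [e, f]" by (auto simp: length_Suc_conv numeral_2_eq_2)
    then show False using q(1) that bip by (cases e; cases f) (auto simp: awalk_simps)
  qed
  show "shifted_harary G x y \<le> 2"
    using bound[of 1] 1 by (cases "x = y") (auto simp: shifted_harary_def)
  show "shifted_harary G x y \<le> 1" if "x \<in> U \<longleftrightarrow> y \<in> U"
  proof (cases "x = y")
    case False
    moreover have "(x, y) \<notin> parcs G" using that bip by auto
    ultimately show ?thesis using bound[of 2] 2 by auto
  qed (simp add: shifted_harary_def)
  show "shifted_harary G x y \<le> 2 / 3" if "x \<in> U \<longleftrightarrow> y \<notin> U" "(x, y) \<notin> parcs G"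
    using bound[of 3] 3[OF that] that by auto
qed

lemma shifted_harary_complete_bipartite:
  assumes p: "0 < p" and m: "0 < m" and x: "x < p + m" and y: "y < p + m"
  shows "shifted_harary (complete_bipartite_graph p m) x y = (if x < p \<longleftrightarrow> y < p then 1 else 2)"
proof -
  let ?K = "complete_bipartite_graph p m"
  interpret pair_graph ?K by (rule pair_graph_complete_bipartite_graph)
  have V: "pverts ?K = {0..<p + m}"
    and E: "\<And>u v. (u, v) \<in> parcs ?K \<longleftrightarrow> u < p + m \<and> v < p + m \<and> (u < p \<longleftrightarrow> \<not> v < p)"
    by (auto simp: complete_bipartite_graph_def)
  show ?thesis
  proof (cases "x < p \<longleftrightarrow> y < p")
    case False
    then have path: "apath x [(x, y)] y" using x y V E by (auto simp: apath_simps)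
    obtain q where "awalk x q y" "length q = graph_dist ?K x y" using graph_dist_attained[OF path] .
    then have "graph_dist ?K x y \<noteq> 0" using False by (cases q) (auto simp: awalk_simps)
    then have "graph_dist ?K x y = 1" using graph_dist_le[OF path] by simp
    then show ?thesis using False by (auto simp: shifted_harary_def)
  next
    case True
    show ?thesis
    proof (cases "x = y")
      case False
      define u where "u = (if x < p then p else 0)"
      have path: "apath x [(x, u), (u, y)] y"
        using x y V E p m True False by (auto simp: apath_simps u_def)
      obtain q where q: "awalk x q y" "length q = graph_dist ?K x y" using graph_dist_attained[OF path] .
      have "length q \<noteq> 0" using q(1) False by (cases q) (auto simp: awalk_simps)
      moreover have "length q \<noteq> 1"
        using q(1) True E by (cases q) (auto simp: awalk_simps)
      moreover have "length q \<le> 2" using graph_dist_le[OF path] q(2) by simp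
      ultimately have "length q = 2" by linarith
      then show ?thesis using True False q(2) by (simp add: shifted_harary_def)
    qed (simp add: shifted_harary_def)
  qed
qed

section \<open>Comparison with complete bipartite graphs\<close>

lemma complete_bipartite_eigenvalue_le:
  fixes p m :: nat and x y :: real
  assumes pm: "0 < p" "0 < m" and "0 < x"
    and eqs: "real p * x + 2 * real m * y = \<kappa> * x" "2 * real p * x + real m * y = \<kappa> * y"
  shows "\<kappa> \<le> 2 * harary_spectral_radius (complete_bipartite_graph p m) + 1"
proof (rule shifted_eigenvalue_le_harary_spectral_radius[where v = 0
      and f = "\<lambda>v. if v \<in> {0..<p} then x else y"])
  let ?K = "complete_bipartite_graph p m"
  let ?f = "\<lambda>v. if v \<in> {0..<p} then x else y"
  have V: "pverts ?K = {0..<p} \<union> {p..<p + m}" by (auto simp: complete_bipartite_graph_def)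
  show "finite (pverts ?K)" by (simp add: V)
  show "0 \<in> pverts ?K" "?f 0 \<noteq> 0" using assms by (auto simp: V)
  fix u assume u: "u \<in> pverts ?K"
  have "(\<Sum>v\<in>pverts ?K. shifted_harary ?K u v * ?f v)
      = (\<Sum>v\<in>{0..<p} \<union> {p..<p + m}. (if u \<in> {0..<p} \<longleftrightarrow> v \<in> {0..<p} then 1 else 2) * ?f v)"
    using u shifted_harary_complete_bipartite[OF pm, of u] unfolding V
    by (intro sum.cong) auto
  also have "\<dots> = \<kappa> * ?f u"
    using u eqs unfolding V by (intro two_class_kernel_eigenvector) auto
  finally show "(\<Sum>v\<in>pverts ?K. shifted_harary ?K u v * ?f v) = \<kappa> * ?f u" .
qed

lemma digraph_iso_complete_bipartite:
  assumes G: "pair_graph G"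
    and bip: "pverts G = C \<union> R" "C \<inter> R = {}" "parcs G = C \<times> R \<union> R \<times> C"
  shows "digraph_iso (with_proj G) (with_proj (complete_bipartite_graph (card C) (card R)))"
proof -
  interpret pair_graph G by (rule G)
  have fin: "finite C" "finite R" using pair_finite_verts bip(1) by auto
  let ?p = "card C" and ?m = "card R"
  obtain c where c: "bij_betw c C {0..<?p}" using fin(1) ex_bij_betw_finite_nat by blast
  obtain r where r: "bij_betw r R {?p..<?p + ?m}"
    using fin(2) finite_same_card_bij[of R "{?p..<?p + ?m}"] by auto
  define \<phi> where "\<phi> x = (if x \<in> C then c x else r x)" for x
  have C: "\<phi> ` C = {0..<?p}" using c by (auto simp: \<phi>_def bij_betw_def)
  have R: "\<phi> ` R = {?p..<?p + ?m}"
  proof -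
    have "\<phi> ` R = r ` R" using bip(2) by (intro image_cong) (auto simp: \<phi>_def)
    then show ?thesis using r by (simp add: bij_betw_def)
  qed
  have "bij_betw \<phi> (C \<union> R) ({0..<?p} \<union> {?p..<?p + ?m})"
  proof (rule bij_betw_combine)
    show "bij_betw \<phi> C {0..<?p}" using c by (rule bij_betw_cong[THEN iffD1, rotated]) (simp add: \<phi>_def)
    show "bij_betw \<phi> R {?p..<?p + ?m}"
      using r by (rule bij_betw_cong[THEN iffD1, rotated]) (use bip(2) in \<open>auto simp: \<phi>_def\<close>)
  qed auto
  then have inj: "inj_on \<phi> (pverts G)" by (simp add: bip(1) bij_betw_def)
  let ?iso = "\<lparr>iso_verts = \<phi>, iso_arcs = map_prod \<phi> \<phi>, iso_head = snd, iso_tail = fst\<rparr>"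
  have "inj_on (map_prod \<phi> \<phi>) (parcs G)"
    using map_prod_inj_on[OF inj inj] by (rule inj_on_subset) (auto dest: wellformed')
  then have "digraph_isomorphism ?iso"
    unfolding digraph_isomorphism_def using inj wf_digraph_axioms by auto
  moreover have "app_iso ?iso (with_proj G) = with_proj (complete_bipartite_graph ?p ?m)"
  proof -
    have "map_prod \<phi> \<phi> ` parcs G = \<phi> ` C \<times> \<phi> ` R \<union> \<phi> ` R \<times> \<phi> ` C"
      unfolding bip(3) image_Un by (simp add: map_prod_surj_on)
    then show ?thesis
      by (auto simp: app_iso_def with_proj_def complete_bipartite_graph_def bip(1) image_Un C R)
  qed
  ultimately show ?thesis by (auto simp: digraph_iso_def intro!: exI[of _ ?iso])
qed

text \<open>
  Under the bipartition \<open>(C, R)\<close> the kernel of \<open>G\<close> is at most that of the complete bipartite graph on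
  the same vertices, and it is at most \<open>2/3 < 2\<close> at the missing edge.
\<close>

lemma harary_less_complete_bipartite_supergraph:
  assumes G: "pair_graph G" and conn: "Digraph_Component.connected (with_proj G)"
    and bip: "pverts G = C \<union> R" "C \<inter> R = {}" "parcs G \<subseteq> C \<times> R \<union> R \<times> C"
    and missing: "a \<in> C" "b \<in> R" "(a, b) \<notin> parcs G"
  shows "harary_spectral_radius G < harary_spectral_radius (complete_bipartite_graph (card C) (card R))"
proof -
  interpret pair_graph G by (rule G)
  have fin: "finite C" "finite R" using pair_finite_verts bip(1) by auto
  then have pm: "0 < card C" "0 < card R" using missing by (auto simp: card_gt_0_iff)
  obtain \<kappa> x y where xy: "0 < x" "0 < y"
    "real (card C) * x + 2 * real (card R) * y = \<kappa> * x"
    "2 * real (card C) * x + real (card R) * y = \<kappa> * y"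
    using two_class_perron[OF pm] .
  obtain w v where w: "\<And>x. 0 \<le> w x" "v \<in> pverts G" "w v \<noteq> 0"
    "\<And>x. x \<in> pverts G \<Longrightarrow>
      (2 * harary_spectral_radius G + 1) * w x \<le> (\<Sum>y\<in>pverts G. shifted_harary G x y * w y)"
    using harary_spectral_radius_subinvariant[of G] pair_finite_verts missing(1) bip(1) by blast
  note le = shifted_harary_le[OF G conn bip(2,1,3)]
  have "2 * harary_spectral_radius G + 1 < \<kappa>"
  proof (rule subinvariant_comparison(2)[where V = "pverts G" and M = "shifted_harary G"
        and H = "\<lambda>u v. if u \<in> C \<longleftrightarrow> v \<in> C then 1 else 2" and z = "\<lambda>v. if v \<in> C then x else y"
        and w = w and v = v and x = a and y = b])
    show "(\<Sum>v\<in>pverts G. (if u \<in> C \<longleftrightarrow> v \<in> C then 1 else 2) * (if v \<in> C then x else y))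
      = \<kappa> * (if u \<in> C then x else y)" if "u \<in> pverts G" for u
      using that xy fin bip(2) unfolding bip(1) by (intro two_class_kernel_eigenvector) auto
    show "shifted_harary G u v \<le> (if u \<in> C \<longleftrightarrow> v \<in> C then 1 else 2)"
      if "u \<in> pverts G" "v \<in> pverts G" for u v
      using le(1,2)[OF that] by auto
    show "shifted_harary G a b < (if a \<in> C \<longleftrightarrow> b \<in> C then 1 else 2)"
      using le(3)[of a b] missing bip by auto
  qed (use w xy missing bip pair_finite_verts in auto)
  also have "\<kappa> \<le> 2 * harary_spectral_radius (complete_bipartite_graph (card C) (card R)) + 1"
    by (rule complete_bipartite_eigenvalue_le[OF pm xy(1,3,4)])
  finally show ?thesis by simp
qed

text \<open>
  A vertex belongs to one of four classes, according to its side and to whether it is in the cover.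
  Two vertices outside the cover are not adjacent, so the kernel of \<open>G\<close> is at most \<open>2/3\<close> between
  \<open>U - A\<close> and \<open>V - B\<close>, and elsewhere it has the bounds of any bipartite graph.
\<close>

lemma harary_less_two_sided_cover:
  assumes G: "pair_graph G" and conn: "Digraph_Component.connected (with_proj G)"
    and bip: "pverts G = U \<union> V" "U \<inter> V = {}" "parcs G \<subseteq> U \<times> V \<union> V \<times> U"
    and A: "A \<subseteq> U" "A \<noteq> {}" and B: "B \<subseteq> V" "B \<noteq> {}"
    and cover: "\<And>x y. (x, y) \<in> parcs G \<Longrightarrow> x \<in> A \<union> B \<or> y \<in> A \<union> B"
    and le: "card A \<le> card (V - B)" "card B \<le> card (U - A)"
  shows "harary_spectral_radius G
    < harary_spectral_radius (complete_bipartite_graph (card A + card B) (card (U - A) + card (V - B)))"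
proof -
  interpret pair_graph G by (rule G)
  have fin: "finite U" "finite V" using pair_finite_verts bip(1) by auto
  have finAB: "finite A" "finite B" using A(1) B(1) fin finite_subset by auto
  let ?s = "card A" and ?t = "card B" and ?k = "card (U - A)" and ?l = "card (V - B)"
  have st: "0 < ?s" "0 < ?t" using finAB A B by (auto simp: card_gt_0_iff)
  define \<tau> where "\<tau> x = (x \<in> U, x \<in> A \<union> B)" for x
  define N :: "bool \<times> bool \<Rightarrow> bool \<times> bool \<Rightarrow> real" where
    "N = (\<lambda>(u, c) (u', c'). if u = u' then 1 else if c \<or> c' then 2 else 2 / 3)"
  define n where "n b = card {x \<in> pverts G. \<tau> x = b}" for b
  have n: "n (True, True) = ?s" "n (False, True) = ?t" "n (True, False) = ?k" "n (False, False) = ?l"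
    unfolding n_def \<tau>_def bip(1) using A B bip(2) by (auto intro!: arg_cong[of _ _ card])
  have n_pos: "0 < n b" for b
    using st le by (cases b; cases "fst b"; cases "snd b") (auto simp: n)
  have N_pos: "0 < N b b'" for b b' by (auto simp: N_def split: prod.split)
  have "0 < N b b' * n b'" for b b' using N_pos n_pos by simp
  then obtain \<theta> z where z: "0 < \<theta>" "\<And>b. 0 < z b" "\<And>b. (\<Sum>b'\<in>UNIV. N b b' * n b' * z b') = \<theta> * z b"
    using positive_kernel_perron[of "\<lambda>b b'. N b b' * n b'"] by metis
  obtain w v where w: "\<And>x. 0 \<le> w x" "v \<in> pverts G" "w v \<noteq> 0"
    "\<And>x. x \<in> pverts G \<Longrightarrow>
      (2 * harary_spectral_radius G + 1) * w x \<le> (\<Sum>y\<in>pverts G. shifted_harary G x y * w y)"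
    using harary_spectral_radius_subinvariant[of G] pair_finite_verts A bip(1) by blast
  note sle = shifted_harary_le[OF G conn bip(2,1,3)]
  have "2 * harary_spectral_radius G + 1 \<le> \<theta>"
  proof (rule subinvariant_comparison(1)[where V = "pverts G" and M = "shifted_harary G"
        and H = "\<lambda>x y. N (\<tau> x) (\<tau> y)" and z = "\<lambda>x. z (\<tau> x)" and w = w and v = v])
    show "(\<Sum>y\<in>pverts G. N (\<tau> x) (\<tau> y) * z (\<tau> y)) = \<theta> * z (\<tau> x)" for x
      using sum_over_classes[OF pair_finite_verts, of "\<lambda>b. N (\<tau> x) b * z b" \<tau>] z(3)[of "\<tau> x"]
      by (simp add: n_def mult_ac)
    show "shifted_harary G x y \<le> N (\<tau> x) (\<tau> y)" if xy: "x \<in> pverts G" "y \<in> pverts G" for x y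
      using sle[OF xy] cover[of x y] by (auto simp: N_def \<tau>_def)
    show "N (\<tau> x) (\<tau> y) = N (\<tau> y) (\<tau> x)" for x y by (auto simp: N_def split: prod.split)
  qed (use w z N_pos pair_finite_verts in auto)
  moreover have pm: "0 < ?s + ?t" "0 < ?k + ?l" using st le by auto
  moreover obtain \<kappa> x y where xy: "0 < x" "0 < y"
    "real (?s + ?t) * x + 2 * real (?k + ?l) * y = \<kappa> * x"
    "2 * real (?s + ?t) * x + real (?k + ?l) * y = \<kappa> * y"
    using two_class_perron[OF pm] .
  moreover have "\<theta> < \<kappa>"
  proof (rule four_class_eigenvalue_less[where s = ?s and t = ?t and k = ?k and l = ?l
        and a = "z (True, True)" and b = "z (False, True)" and c = "z (True, False)"
        and d = "z (False, False)" and x = x and y = y])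
  qed (use st le xy z(1,2) z(3)[of "(True, True)"] z(3)[of "(False, True)"] z(3)[of "(True, False)"]
      z(3)[of "(False, False)"] in \<open>auto simp: sum_bool_pair N_def n algebra_simps\<close>)
  moreover have "\<kappa> \<le> 2 * harary_spectral_radius (complete_bipartite_graph (?s + ?t) (?k + ?l)) + 1"
    by (rule complete_bipartite_eigenvalue_le[OF pm xy(1,3,4)])
  ultimately show ?thesis by simp
qed

theorem theorem4p5:
  fixes G :: "'a pair_pre_digraph" and n p :: nat
  assumes "pair_graph G"
    and "Digraph_Component.connected (with_proj G)"
    and "bipartite G"
    and "card (pverts G) = n"
    and "matching_number G = p"
    and "\<not> digraph_iso (with_proj G) (with_proj (complete_bipartite_graph p (n - p)))"
  shows "harary_spectral_radius G < harary_spectral_radius (complete_bipartite_graph p (n - p))"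
proof -
  interpret pair_graph G by (rule assms(1))
  obtain U V where bip: "pverts G = U \<union> V" "U \<inter> V = {}" "parcs G \<subseteq> U \<times> V \<union> V \<times> U"
    using assms(3) by (auto simp: bipartite_def)
  obtain A B where AB: "A \<subseteq> U" "B \<subseteq> V"
    and cover: "\<And>x y. (x, y) \<in> parcs G \<Longrightarrow> x \<in> A \<union> B \<or> y \<in> A \<union> B"
    and card: "card A + card B = p" "card A \<le> card (V - B)" "card B \<le> card (U - A)"
    using koenig[OF assms(1) bip] assms(5) by metis
  define C where "C = A \<union> B"
  define R where "R = pverts G - C"
  have fin: "finite U" "finite V" using pair_finite_verts bip(1) by auto
  have finAB: "finite A" "finite B" using AB fin finite_subset by auto
  have C: "card C = p"
    using card(1) card_Un_disjoint[OF finAB] AB bip(2) by (auto simp: C_def)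
  have sub: "C \<subseteq> pverts G" using AB bip(1) by (auto simp: C_def)
  have R: "card R = n - p"
    using sub finAB C assms(4) by (simp add: R_def card_Diff_subset C_def)
  have R_split: "card R = card (U - A) + card (V - B)"
  proof -
    have "R = (U - A) \<union> (V - B)" using AB bip by (auto simp: R_def C_def)
    then show ?thesis using fin bip(2) by (auto intro!: card_Un_disjoint)
  qed
  show ?thesis
  proof (cases "A = {} \<or> B = {}")
    case False
    then show ?thesis
      using harary_less_two_sided_cover[OF assms(1,2) bip AB(1) _ AB(2) _ cover card(2,3)] card(1) R R_split
      by simp
  next
    case True
    have CR: "pverts G = C \<union> R" "C \<inter> R = {}" using sub by (auto simp: R_def)
    \<comment> \<open>A cover inside one side is itself one part of a bipartition.\<close>
    have arcs: "parcs G \<subseteq> C \<times> R \<union> R \<times> C"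
    proof
      fix e assume e: "e \<in> parcs G"
      obtain x y where xy: "e = (x, y)" by (cases e)
      show "e \<in> C \<times> R \<union> R \<times> C"
        using subsetD[OF bip(3) e] bip(1,2) AB True cover[of x y] e unfolding xy R_def C_def by blast
    qed
    have "\<exists>a b. a \<in> C \<and> b \<in> R \<and> (a, b) \<notin> parcs G"
    proof (rule ccontr)
      assume "\<nexists>a b. a \<in> C \<and> b \<in> R \<and> (a, b) \<notin> parcs G"
      then have "parcs G = C \<times> R \<union> R \<times> C" using arcs arcs_symmetric by auto
      from digraph_iso_complete_bipartite[OF assms(1) CR this] show False
        using assms(6) C R by simp
    qed
    then show ?thesis
      using harary_less_complete_bipartite_supergraph[OF assms(1,2) CR arcs] C R by metis
  qed
qed

end
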